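(* Let $d\ge 3$, $\mathcal A=\{0,1,\dots,d-1\}$, let $\varphi_d$ be the morphism $\varphi_d(i)=0(i+1)$ for $0\le i\le d-2$, $\varphi_d(d-1)=0(d-1)(d-1)$, and let $\mathbf u_d$ be its fixed point. Let $\pi:\mathcal A^*\to\{\mathtt a,\mathtt b\}^*$ be the morphism $\pi(i)=\mathtt a\mathtt b^i$ for every $i\in\mathcal A$. Then the binary sequence $\pi(\mathbf u_d)$ is rich.
   Context: The fixed point $\mathbf u_d$ is the unique infinite word starting with $0$ with $\varphi_d(\mathbf u_d)=\mathbf u_d$. A finite word of length $n$ is rich if it contains $n+1$ distinct palindromic factors (the empty word included); a sequence is rich if all its factors are rich. *)

theory Defs
  imports "HOL-Library.Stream" "HOL-Library.Sublist"
begin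

(* phi d i is the image of the letter i; only letters i < d are meaningful. *)
definition phi :: "nat \<Rightarrow> nat \<Rightarrow> nat list" where
  "phi d i = (if i = d - 1 then [0, d - 1, d - 1] else [0, i + 1])"

datatype binary_letter = La | Lb

definition pi_map :: "nat \<Rightarrow> binary_letter list" where
  "pi_map i = La # replicate i Lb"

(* The morphism of free monoids determined by letter images f is w \<mapsto> concat (map f w).
   Its extension to infinite words uses Stream.flat, which concatenates a stream of
   lists correctly only if all the lists are nonempty; this holds for phi and pi_map. *)
definition morphism_stream :: "('a \<Rightarrow> 'b list) \<Rightarrow> 'a stream \<Rightarrow> 'b stream" where
  "morphism_stream f s = flat (smap f s)"

(* The theorem ex1_u_word below shows that the description is proper for d \<ge> 2. *)
definition u_word :: "nat \<Rightarrow> nat stream" where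
  "u_word d = (THE u. u \<in> streams {..<d} \<and> shd u = 0 \<and> morphism_stream (phi d) u = u)"

definition palindrome :: "'a list \<Rightarrow> bool" where
  "palindrome w \<longleftrightarrow> rev w = w"

definition rich :: "'a list \<Rightarrow> bool" where
  "rich w \<longleftrightarrow> card {v. sublist v w \<and> palindrome v} = length w + 1"

definition stream_factor :: "'a list \<Rightarrow> 'a stream \<Rightarrow> bool" where
  "stream_factor w s \<longleftrightarrow> (\<exists>p t. s = p @- w @- t)"

definition rich_stream :: "'a stream \<Rightarrow> bool" where
  "rich_stream s \<longleftrightarrow> (\<forall>w. stream_factor w s \<longrightarrow> rich w)"

lemma morphism_stream_shift:
  assumes "\<And>i. f i \<noteq> []"
  shows "morphism_stream f (w @- s) = concat (map f w) @- morphism_stream f s"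
  using assms by (induction w) (auto simp: morphism_stream_def flat_Stream)

lemma phi_not_Nil: "phi d i \<noteq> []"
  by (simp add: phi_def)

lemma phi_set: "d \<ge> 2 \<Longrightarrow> i < d \<Longrightarrow> set (phi d i) \<subseteq> {..<d}"
  by (auto simp: phi_def)

lemma length_phi: "length (phi d i) \<ge> 2"
  by (simp add: phi_def)

lemma length_concat_phi: "length (concat (map (phi d) w)) \<ge> 2 * length w"
proof (induction w)
  case (Cons i w)
  then show ?case using length_phi[of d i] by simp
qed simp

lemma stake_mono_eq:
  assumes "stake m u = stake m v" "n \<le> m"
  shows "stake n u = stake n v"
  using assms by (metis take_stake min.absorb1)

lemma u_word_unique:
  assumes "shd u = 0" "morphism_stream (phi d) u = u"
    and "shd v = 0" "morphism_stream (phi d) v = v"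
  shows "u = v"
proof -
  have step: "stake (Suc n) u = stake (Suc n) v" for n
  proof (induction n)
    case 0
    then show ?case using assms by simp
  next
    case (Suc n)
    define w where "w = stake (Suc n) u"
    define c where "c = concat (map (phi d) w)"
    have u: "u = c @- morphism_stream (phi d) (sdrop (Suc n) u)"
      unfolding c_def w_def
      by (metis assms(2) morphism_stream_shift phi_not_Nil stake_sdrop)
    have v: "v = c @- morphism_stream (phi d) (sdrop (Suc n) v)"
      unfolding c_def w_def Suc.IH
      by (metis assms(4) morphism_stream_shift phi_not_Nil stake_sdrop)
    have "length w = Suc n" by (simp only: w_def length_stake)
    then have "length c \<ge> Suc (Suc n)"
      unfolding c_def using length_concat_phi[of w d] by linarith
    moreover have "stake (length c) u = stake (length c) v"
      by (subst u, subst v) (simp add: stake_shift)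
    ultimately show ?case by (rule stake_mono_eq[rotated])
  qed
  have "u !! n = v !! n" for n
    using step[of n] by (metis stake_nth lessI)
  then show ?thesis
    by (metis ext stream_smap_nats)
qed

lemma u_word_exists:
  assumes d: "d \<ge> 2"
  shows "\<exists>u. u \<in> streams {..<d} \<and> shd u = 0 \<and> morphism_stream (phi d) u = u"
proof -
  define W where "W n = ((\<lambda>w. concat (map (phi d) w)) ^^ n) [0]" for n
  have W0: "W 0 = [0]" and WS: "\<And>n. W (Suc n) = concat (map (phi d) (W n))"
    by (simp_all add: W_def)
  have pre1: "prefix (W n) (W (Suc n))" for n
  proof (induction n)
    case 0
    then show ?case by (simp add: W_def phi_def)
  next
    case (Suc n)
    then obtain z where "W (Suc n) = W n @ z" by (auto simp: prefix_def)
    then have "W (Suc (Suc n)) = W (Suc n) @ concat (map (phi d) z)"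
      by (simp add: WS[of "Suc n"] WS[of n])
    then show ?case by (simp add: prefix_def)
  qed
  have pre: "prefix (W n) (W (n + k))" for n k
  proof (induction k)
    case (Suc k)
    then show ?case using pre1[of "n + k"] by (auto intro: prefix_order.trans)
  qed simp
  have len: "length (W n) \<ge> Suc n" for n
  proof (induction n)
    case (Suc n)
    then show ?case using length_concat_phi[of "W n" d] by (simp add: WS)
  qed (simp add: W0)
  have setW: "set (W n) \<subseteq> {..<d}" for n
  proof (induction n)
    case 0
    then show ?case using d by (simp add: W0)
  next
    case (Suc n)
    then show ?case using phi_set[OF d] by (fastforce simp: WS)
  qed
  define u where "u = smap (\<lambda>n. W n ! n) nats"
  have u_nth: "u !! n = W n ! n" for n by (simp add: u_def)
  have nthW: "W n ! i = W i ! i" if "i < length (W n)" for n i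
  proof (cases "i \<le> n")
    case True
    then show ?thesis using pre[of i "n - i"] len[of i]
      by (auto simp: prefix_def nth_append)
  next
    case False
    then show ?thesis using pre[of n "i - n"] that
      by (auto simp: prefix_def nth_append)
  qed
  have stakeW: "stake (length (W n)) u = W n" for n
    by (rule nth_equalityI) (simp_all add: u_nth nthW)
  have "morphism_stream (phi d) u !! n = u !! n" for n
  proof -
    have "morphism_stream (phi d) u
        = W (Suc n) @- morphism_stream (phi d) (sdrop (length (W n)) u)"
      unfolding WS by (metis stakeW morphism_stream_shift phi_not_Nil stake_sdrop)
    moreover have n: "n < length (W (Suc n))" using len[of "Suc n"] by simp
    ultimately have "morphism_stream (phi d) u !! n = W (Suc n) ! n"
      by simp
    then show ?thesis using nthW[OF n] by (simp add: u_nth)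
  qed
  then have "morphism_stream (phi d) u = u"
    by (metis ext stream_smap_nats)
  moreover have "u \<in> streams {..<d}"
  proof -
    have "u !! n \<in> {..<d}" for n
      using setW[of n] len[of n] nth_mem[of n "W n"]
      by (simp only: u_nth) (meson Suc_le_lessD subsetD)
    then show ?thesis by (simp add: streams_iff_snth)
  qed
  moreover have "shd u = 0" using u_nth[of 0] by (simp add: W0)
  ultimately show ?thesis by blast
qed

theorem ex1_u_word:
  assumes "d \<ge> 2"
  shows "\<exists>!u. u \<in> streams {..<d} \<and> shd u = 0 \<and> morphism_stream (phi d) u = u"
  using u_word_exists[OF assms] u_word_unique by blast

end

theory Submission
  imports Defs
begin

text \<open>
  A word is rich as soon as all complete returns to palindromes are palindromes, so this is what
  has to be shown for \<open>\<pi>(u)\<close>. Both \<open>\<phi>\<close> and \<open>\<pi>\<close> send each letter to a marker followed by a power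
  of one letter, and an occurrence of a palindrome in the image determines a shorter palindrome \<open>w\<close> in the
  preimage together with a constraint on its two neighbouring letters. The constraint is either
  unsatisfiable or amounts to membership in a set of the form \<open>{m}\<close> or \<open>{m..}\<close>. One therefore proves the
  stronger statement that the complete returns of a palindrome \<open>w\<close> flanked by letters from such a set
  are palindromes; it is stable under \<open>\<phi>\<close>, hence follows for \<open>u = \<phi>(u)\<close> by induction on the length
  of \<open>w\<close>, and one application of \<open>\<pi>\<close> gives the theorem.
\<close>

declare upt_Suc [simp del]

lemma upt_single [simp]: "[i..<Suc i] = [i]"
  by (simp add: upt_conv_Cons)

section \<open>Occurrences, complete returns and windows\<close>

definition consecutive :: "(nat \<Rightarrow> bool) \<Rightarrow> nat \<Rightarrow> nat \<Rightarrow> bool" where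
  "consecutive Q i j \<longleftrightarrow> i < j \<and> Q i \<and> Q j \<and> (\<forall>k. i < k \<longrightarrow> k < j \<longrightarrow> \<not> Q k)"

definition occurs :: "(nat \<Rightarrow> 'a) \<Rightarrow> 'a list \<Rightarrow> nat \<Rightarrow> bool" where
  "occurs x v i \<longleftrightarrow> map x [i..<i + length v] = v"

text \<open>The two occurrences may overlap. A word that occurs at most once satisfies the condition
  vacuously.\<close>

definition pal_returns :: "(nat \<Rightarrow> 'a) \<Rightarrow> 'a list \<Rightarrow> bool" where
  "pal_returns x v \<longleftrightarrow>
    (\<forall>i j. consecutive (occurs x v) i j \<longrightarrow> palindrome (map x [i..<j + length v]))"

text \<open>The flanking letters of \<open>v\<close> are at positions \<open>i\<close> and \<open>i + n\<close>, so \<open>n = length v + 1\<close>; for \<open>n = 0\<close>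
  and \<open>v = []\<close> the two coincide and a window is just a letter of \<open>S\<close>.\<close>
definition window :: "(nat \<Rightarrow> 'a) \<Rightarrow> 'a set \<Rightarrow> nat \<Rightarrow> 'a list \<Rightarrow> nat \<Rightarrow> bool" where
  "window x S n v i \<longleftrightarrow> x i \<in> S \<and> x (i + n) \<in> S \<and> map x [Suc i..<i + n] = v"

text \<open>The outer flanking letters, at \<open>i\<close> and \<open>j + n\<close>, are left out
  of the word: both lie in \<open>S\<close>, but they may differ.\<close>

definition window_returns :: "(nat \<Rightarrow> 'a) \<Rightarrow> 'a set \<Rightarrow> nat \<Rightarrow> 'a list \<Rightarrow> bool" where
  "window_returns x S n v \<longleftrightarrow>
    (\<forall>i j. consecutive (window x S n v) i j \<longrightarrow> palindrome (map x [Suc i..<j + n]))"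

lemma palindrome_Nil [simp]: "palindrome []"
  and palindrome_single [simp]: "palindrome [a]"
  and palindrome_replicate [simp]: "palindrome (replicate n a)"
  by (simp_all add: palindrome_def)

lemma palindrome_enclose [simp]: "palindrome (a # v @ [a]) \<longleftrightarrow> palindrome v"
  by (simp add: palindrome_def)

lemma palindrome_cases:
  assumes "palindrome v"
  obtains "v = []" | a where "v = [a]" | a w where "v = a # w @ [a]" "palindrome w"
proof -
  consider "v = []" | a where "v = [a]" | a w b where "v = a # w @ [b]"
    by (metis neq_Nil_conv rev_exhaust)
  then show thesis
  proof cases
    case (3 a w b)
    have eq: "rev (a # w @ [b]) = a # w @ [b]"
      using assms unfolding palindrome_def 3 .
    have "b = a" using arg_cong[OF eq, of hd] by simp
    moreover have "palindrome w"
      unfolding palindrome_def using arg_cong[OF eq, of "\<lambda>l. butlast (tl l)"] by simp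
    ultimately show thesis using that(3) 3 by blast
  qed (rule that, assumption)+
qed
lemma consecutive_cong: "(\<And>k. P k = Q k) \<Longrightarrow> consecutive P i j = consecutive Q i j"
  by (simp add: consecutive_def)

lemma consecutive_UNIV: "(\<And>k. Q k) \<Longrightarrow> consecutive Q i j \<longleftrightarrow> j = Suc i"
proof
  assume "consecutive Q i j" and Q: "\<And>k. Q k"
  then have "i < j" "\<not> Suc i < j" by (auto simp: consecutive_def)
  then show "j = Suc i" by simp
qed (simp add: consecutive_def)

lemma consecutiveI_unique:
  assumes "consecutive Q i j" "Q k" "i < k" "k \<le> j"
  shows "k = j"
  using assms by (auto simp: consecutive_def)

lemma upt_enclose: "i < j \<Longrightarrow> [i..<Suc j] = i # [Suc i..<j] @ [j]"
  by (simp add: upt_conv_Cons upt_Suc)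

lemma upt_append: "i \<le> j \<Longrightarrow> j \<le> k \<Longrightarrow> [i..<j] @ [j..<k] = [i..<k]"
  using upt_add_eq_append[of i j "k - j"] by simp

lemma pal_returns_Nil: "pal_returns x []"
  by (auto simp: pal_returns_def occurs_def consecutive_UNIV)

lemma occurs_single: "occurs x [a] i \<longleftrightarrow> window x {a} 0 [] i"
  by (auto simp: occurs_def window_def)

lemma pal_returns_single: "pal_returns x [a] \<longleftrightarrow> window_returns x {a} 0 []"
proof -
  have "palindrome (map x [i..<j + length [a]]) \<longleftrightarrow> palindrome (map x [Suc i..<j + 0])"
    if "consecutive (window x {a} 0 []) i j" for i j
  proof -
    from that have "map x [i..<j + length [a]] = a # map x [Suc i..<j + 0] @ [a]"
      by (auto simp: consecutive_def window_def upt_enclose)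
    then show ?thesis by simp
  qed
  then show ?thesis
    unfolding pal_returns_def window_returns_def
    by (simp add: consecutive_cong[OF occurs_single])
qed

lemma occurs_enclose: "occurs x (a # v @ [a]) i \<longleftrightarrow> window x {a} (Suc (length v)) v i"
proof -
  have "[i..<i + length (a # v @ [a])]
      = i # [Suc i..<i + Suc (length v)] @ [i + Suc (length v)]"
    using upt_enclose[of i "i + Suc (length v)"] by simp
  then show ?thesis unfolding occurs_def window_def by auto
qed

lemma pal_returns_enclose:
  "pal_returns x (a # v @ [a]) \<longleftrightarrow> window_returns x {a} (Suc (length v)) v"
proof -
  have "palindrome (map x [i..<j + length (a # v @ [a])])
      \<longleftrightarrow> palindrome (map x [Suc i..<j + Suc (length v)])"
    if "consecutive (window x {a} (Suc (length v)) v) i j" for i j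
  proof -
    from that have "map x [i..<j + length (a # v @ [a])]
        = a # map x [Suc i..<j + Suc (length v)] @ [a]"
      using upt_enclose[of i "j + Suc (length v)"] by (auto simp: consecutive_def window_def)
    then show ?thesis by simp
  qed
  then show ?thesis
    unfolding pal_returns_def window_returns_def
    by (simp only: consecutive_cong[OF occurs_enclose]) blast
qed

text \<open>A palindrome of length at least two is its interior flanked on both sides by
  \<open>{a}\<close>, and a letter is the case \<open>n = 0\<close>. Complete returns thus reduce to
  window returns for singletons; the empty word occurs everywhere.\<close>

lemma pal_returnsI:
  assumes "palindrome w"
    and "\<And>a. window_returns x {a} 0 []"
    and "\<And>a v. palindrome v \<Longrightarrow> length w = Suc (Suc (length v)) \<Longrightarrow>
      window_returns x {a} (Suc (length v)) v"
  shows "pal_returns x w"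
  using assms(1)
proof (cases rule: palindrome_cases)
  case 1 then show ?thesis by (simp add: pal_returns_Nil)
next
  case (2 a) then show ?thesis using assms(2) by (simp add: pal_returns_single)
next
  case (3 a v) then show ?thesis using assms(3) by (simp add: pal_returns_enclose)
qed

text \<open>Flanks are always letters that occur in \<open>x\<close>. This allows preimages of
  letter sets to be simplified within the range of \<open>x\<close>.\<close>

lemma window_returns_cong:
  assumes "S \<inter> range x = T \<inter> range x"
  shows "window_returns x S n v = window_returns x T n v"
proof -
  have "window x S n v = window x T n v"
    using assms by (auto simp: window_def fun_eq_iff)
  then show ?thesis by (simp add: window_returns_def)
qed

lemma window_returns_empty: "S \<inter> range x = {} \<Longrightarrow> window_returns x S n v"
  by (auto simp: window_returns_def consecutive_def window_def)

lemma window_returns_subset_single: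
  "T \<subseteq> {m} \<Longrightarrow> window_returns x {m} n v \<Longrightarrow> window_returns x T n v"
  by (auto dest!: subset_singletonD intro: window_returns_empty)

lemma window_returns_UNIV_0: "window_returns x UNIV 0 []"
  by (auto simp: window_returns_def window_def consecutive_UNIV)

text \<open>Without a restriction on the flanks, a window at \<open>i\<close> is an occurrence at
  \<open>Suc i\<close>, and consecutive ones correspond.\<close>

lemma window_returns_UNIV:
  assumes "pal_returns x v"
  shows "window_returns x UNIV (Suc (length v)) v"
  unfolding window_returns_def
proof (intro allI impI)
  fix i j assume "consecutive (window x UNIV (Suc (length v)) v) i j"
  then have "consecutive (occurs x v) (Suc i) (Suc j)"
    by (auto simp: consecutive_def window_def occurs_def)
       (metis Suc_less_eq2 Suc_less_eq add_Suc)
  with assms show "palindrome (map x [Suc i..<j + Suc (length v)])"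
    by (fastforce simp: pal_returns_def)
qed

subsection \<open>Complete returns and richness\<close>

lemma sublist_map_upt:
  "sublist v (map x [i..<j]) \<longleftrightarrow> v = [] \<or> (\<exists>p. i \<le> p \<and> p + length v \<le> j \<and> occurs x v p)"
proof
  assume "sublist v (map x [i..<j])"
  then obtain a b where ab: "map x [i..<j] = a @ v @ b" by (auto simp: sublist_def)
  have len: "j - i = length a + length v + length b"
    using arg_cong[OF ab, of length] by simp
  show "v = [] \<or> (\<exists>p. i \<le> p \<and> p + length v \<le> j \<and> occurs x v p)"
  proof (cases "v = []")
    case False
    then have "length v > 0" by simp
    then have ij: "i + length a + length v \<le> j" using len by linarith
    have "v = take (length v) (drop (length a) (map x [i..<j]))" by (simp add: ab)
    also have "\<dots> = map x [i + length a..<i + length a + length v]"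
      using ij by (simp add: take_map drop_map)
    finally have "occurs x v (i + length a)" by (simp add: occurs_def)
    with ij show ?thesis by (metis le_add1)
  qed simp
next
  assume "v = [] \<or> (\<exists>p. i \<le> p \<and> p + length v \<le> j \<and> occurs x v p)"
  then show "sublist v (map x [i..<j])"
  proof
    assume "\<exists>p. i \<le> p \<and> p + length v \<le> j \<and> occurs x v p"
    then obtain p where p: "i \<le> p" "p + length v \<le> j" and v: "map x [p..<p + length v] = v"
      by (auto simp: occurs_def)
    have "[i..<j] = [i..<p] @ [p..<p + length v] @ [p + length v..<j]"
      using p by (metis le_add1 le_trans upt_append)
    then have "map x [i..<j] = map x [i..<p] @ v @ map x [p + length v..<j]"
      by (metis map_append v)
    then show ?thesis by (metis sublist_appendI)
  qed simp
qed

lemma occurs_map_upt: "i \<le> j \<Longrightarrow> occurs x (map x [i..<j]) i"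
  by (simp add: occurs_def)

text \<open>The longest palindromic suffix of a prefix is new: an earlier occurrence would give a
  complete return, hence a longer palindromic suffix.\<close>
lemma rich_map_upt:
  assumes ret: "\<And>v. palindrome v \<Longrightarrow> pal_returns x v"
  shows "rich (map x [i..<i + n])"
proof (induction n)
  case 0
  have "{v. sublist v (map x [i..<i + 0]) \<and> palindrome v} = {[]}" by auto
  then show ?case by (simp only: rich_def) simp
next
  case (Suc n)
  define j where "j = i + n"
  define pals where "pals m = {v. sublist v (map x [i..<m]) \<and> palindrome v}" for m
  have fin: "finite (pals m)" for m
    by (rule finite_subset[of _ "set (sublists (map x [i..<m]))"]) (auto simp: pals_def)
  define suf where "suf p \<longleftrightarrow> i \<le> p \<and> p \<le> j \<and> palindrome (map x [p..<Suc j])" for p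
  have "suf j" by (simp add: suf_def j_def)
  define p where "p = (LEAST p. suf p)"
  have p: "suf p" using \<open>suf j\<close> unfolding p_def by (rule LeastI)
  have p_le: "p \<le> p'" if "suf p'" for p' using that unfolding p_def by (rule Least_le)
  define P where "P = map x [p..<Suc j]"
  have lenP: "length P = Suc j - p" by (simp add: P_def)
  have pij: "i \<le> p" "p \<le> j" and palP: "palindrome P" using p by (simp_all only: suf_def P_def)
  have new: "P \<notin> pals j"
  proof
    assume "P \<in> pals j"
    then obtain p1 where "i \<le> p1" "p1 + length P \<le> j" "occurs x P p1"
      using lenP pij by (auto simp: pals_def sublist_map_upt)
    then have ex: "p1 < p \<and> occurs x P p1" "i \<le> p1" using lenP pij by auto
    \<comment> \<open>Taking the last occurrence before \<open>p\<close> makes \<open>p2\<close> and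
      \<open>p\<close> consecutive.\<close>
    define p2 where "p2 = (GREATEST k. k < p \<and> occurs x P k)"
    have p2: "p2 < p \<and> occurs x P p2" unfolding p2_def
      by (rule GreatestI_nat[of _ _ p]) (use ex in auto)
    have max: "k \<le> p2" if "k < p \<and> occurs x P k" for k unfolding p2_def
      by (rule Greatest_le_nat[of _ _ p]) (use that in auto)
    have "occurs x P p" unfolding P_def by (rule occurs_map_upt) (use pij in simp)
    then have "consecutive (occurs x P) p2 p"
      using p2 max by (auto simp: consecutive_def not_less[symmetric])
    then have "palindrome (map x [p2..<p + length P])"
      using ret[OF palP] by (simp add: pal_returns_def)
    moreover have "p + length P = Suc j" using lenP pij by simp
    moreover have "i \<le> p2" using max[OF ex(1)] ex(2) by simp
    ultimately have "suf p2" using p2 pij by (simp add: suf_def)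
    then show False using p_le p2 by fastforce
  qed
  have "pals (Suc j) = insert P (pals j)"
  proof (intro equalityI subsetI)
    fix v assume v: "v \<in> pals (Suc j)"
    show "v \<in> insert P (pals j)"
    proof (cases "v = []")
      case True then show ?thesis by (simp add: pals_def)
    next
      case False
      then obtain k where k: "i \<le> k" "k + length v \<le> Suc j" "occurs x v k"
        and palv: "palindrome v"
        using v by (auto simp: pals_def sublist_map_upt)
      show ?thesis
      proof (cases "k + length v = Suc j")
        case False
        with k palv show ?thesis by (auto simp: pals_def sublist_map_upt)
      next
        case True
        then have veq: "v = map x [k..<Suc j]" using k(3) by (simp add: occurs_def)
        then have "suf k" using True False k palv by (cases v) (auto simp: suf_def)
        then have "p \<le> k" by (rule p_le)
        show ?thesis
        proof (cases "p = k")
          case True then show ?thesis using veq P_def by simp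
        next
          case False
          with \<open>p \<le> k\<close> have "p < k" by simp
          \<comment> \<open>A palindromic suffix \<open>v\<close> shorter than the longest one,
            \<open>P\<close>, is by reversal also a prefix of \<open>P\<close>. It therefore occurs
            before the last letter is added and is not new.\<close>
          have "P = map x [p..<k] @ v"
            unfolding P_def veq using \<open>p < k\<close> \<open>suf k\<close>
            by (metis map_append upt_append less_imp_le le_SucI suf_def)
          then have "P = v @ rev (map x [p..<k])"
            using palP palv by (metis palindrome_def rev_append)
          then have "v = take (length v) P" by simp
          also have "\<dots> = map x [p..<p + length v]"
            using True \<open>p < k\<close> by (simp add: P_def take_map)
          finally have "occurs x v p" by (simp add: occurs_def)
          moreover have "p + length v \<le> j" using True \<open>p < k\<close> by simp
          ultimately show ?thesis using pij palv by (auto simp: pals_def sublist_map_upt)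
        qed
      qed
    qed
  next
    fix v assume "v \<in> insert P (pals j)"
    then show "v \<in> pals (Suc j)"
    proof
      assume "v = P"
      moreover have "occurs x P p" unfolding P_def by (rule occurs_map_upt) (use pij in simp)
      ultimately show ?thesis using palP lenP pij by (auto simp: pals_def sublist_map_upt)
    next
      assume "v \<in> pals j"
      then show ?thesis by (auto simp: pals_def sublist_map_upt)
    qed
  qed
  then have "card (pals (Suc j)) = Suc (card (pals j))" using new fin by simp
  then show ?case using Suc.IH by (simp add: rich_def pals_def j_def)
qed

lemma rich_streamI:
  assumes "\<And>v. palindrome v \<Longrightarrow> pal_returns (snth s) v"
  shows "rich_stream s"
  unfolding rich_stream_def
proof (intro allI impI)
  fix w assume "stream_factor w s"
  then obtain p t where s: "s = p @- w @- t" by (auto simp: stream_factor_def)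
  have "w = map (snth s) [length p..<length p + length w]"
    by (rule nth_equalityI) (auto simp: s)
  then show "rich w" using rich_map_upt[OF assms] by metis
qed

subsection \<open>Morphisms whose blocks are a marker followed by a power of a letter\<close>

text \<open>The word \<open>y\<close> is the image of \<open>x\<close> under the morphism sending
  \<open>z\<close> to \<open>c\<close> followed by \<open>h z\<close> to the power
  \<open>e z\<close>, and \<open>g k\<close> is the position of the marker of the block of
  \<open>x k\<close>. By \<open>blocks_inj\<close> the image can be decoded; by
  \<open>long_blocks\<close> all powers with exponent at least two use the same letter.\<close>

locale power_blocks =
  fixes c :: 'b and h :: "'a \<Rightarrow> 'b" and e :: "'a \<Rightarrow> nat"
    and x :: "nat \<Rightarrow> 'a" and y :: "nat \<Rightarrow> 'b" and g :: "nat \<Rightarrow> nat"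
  assumes h_neq: "h z \<noteq> c"
    and blocks_inj: "replicate (e z) (h z) = replicate (e z') (h z') \<Longrightarrow> z = z'"
    and long_blocks: "2 \<le> e z \<Longrightarrow> 2 \<le> e z' \<Longrightarrow> h z = h z'"
    and g_0: "g 0 = 0"
    and g_Suc: "g (Suc k) = Suc (g k + e (x k))"
    and y_block: "t \<le> e (x k) \<Longrightarrow> y (g k + t) = (c # replicate (e (x k)) (h (x k))) ! t"
begin

section \<open>Coding by blocks and unique decoding\<close>

text \<open>The marker is moved behind its block, so that \<open>c # enc w\<close> is the image of
  \<open>w\<close> closed by one more marker. In this form reversal commutes with the coding,
  because each power is a palindrome.\<close>

definition enc :: "'a list \<Rightarrow> 'b list" where
  "enc w = concat (map (\<lambda>z. replicate (e z) (h z) @ [c]) w)"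

lemma enc_simps [simp]:
  "enc [] = []"
  "enc (z # w) = replicate (e z) (h z) @ c # enc w"
  "enc (w @ w') = enc w @ enc w'"
  by (simp_all add: enc_def)

lemma rev_enc: "rev (enc w) @ [c] = c # enc (rev w)"
proof (induction w)
  case (Cons z w)
  have "rev (enc (z # w)) @ [c] = (rev (enc w) @ [c]) @ replicate (e z) (h z) @ [c]" by simp
  then show ?case unfolding Cons.IH by simp
qed simp

lemma palindrome_enc: "palindrome w \<Longrightarrow> palindrome (c # enc w)"
  using rev_enc[of w] by (simp add: palindrome_def)

lemma palindrome_enc_enclose: "palindrome w \<Longrightarrow> palindrome (a @ (c # enc w) @ rev a)"
  using palindrome_enc[of w] by (simp add: palindrome_def)

lemma first_marker:
  "a @ c # b = a' @ c # b' \<Longrightarrow> c \<notin> set a \<Longrightarrow> c \<notin> set a' \<Longrightarrow> a = a' \<and> b = b'"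
proof (induction a arbitrary: a')
  case Nil then show ?case by (cases a') auto
next
  case (Cons z a) then show ?case by (cases a') auto
qed

lemma marker_notin [simp]: "c \<notin> set (replicate n (h z))"
  using h_neq[of z] by auto

lemma enc_inj: "enc w = enc w' \<Longrightarrow> w = w'"
proof (induction w arbitrary: w')
  case Nil then show ?case by (cases w') auto
next
  case (Cons z w)
  then obtain z' v where w': "w' = z' # v" by (cases w') auto
  have "replicate (e z) (h z) = replicate (e z') (h z') \<and> enc w = enc v"
    using Cons.prems unfolding w' by (intro first_marker marker_notin) simp
  then show ?case using Cons.IH blocks_inj w' by auto
qed

text \<open>The first marker determines the left border; after reversal the same argument determines
  the right one, and injectivity of the coding gives the middle.\<close>

lemma enc_decomp_unique:
  assumes eq: "a @ c # enc w @ b = a' @ c # enc w' @ b'"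
    and "c \<notin> set a" "c \<notin> set b" "c \<notin> set a'" "c \<notin> set b'"
  shows "a = a' \<and> w = w' \<and> b = b'"
proof -
  have *: "a = a'" "enc w @ b = enc w' @ b'" using first_marker[OF eq] assms by auto
  have "rev (c # enc w @ b) = rev b @ c # enc (rev w)"
    "rev (c # enc w' @ b') = rev b' @ c # enc (rev w')"
    by (simp_all add: rev_enc)
  with * have "rev b @ c # enc (rev w) = rev b' @ c # enc (rev w')" by metis
  then have "rev b = rev b' \<and> enc (rev w) = enc (rev w')"
    by (rule first_marker) (use assms in auto)
  then show ?thesis using * enc_inj by auto
qed

section \<open>Positions of blocks in the image\<close>

lemma y_marker [simp]: "y (g k) = c"
  using y_block[of 0 k] by simp

lemma y_inner: "t < e (x k) \<Longrightarrow> y (Suc (g k + t)) = h (x k)"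
  using y_block[of "Suc t" k] by simp

lemma strict_mono_g: "strict_mono g"
  by (simp add: strict_mono_Suc_iff g_Suc)

lemma g_less_iff [simp]: "g k < g l \<longleftrightarrow> k < l"
  by (rule strict_mono_less[OF strict_mono_g])

lemma g_le_iff [simp]: "g k \<le> g l \<longleftrightarrow> k \<le> l"
  by (rule strict_mono_less_eq[OF strict_mono_g])

lemma block_decomp: "\<exists>k t. n = g k + t \<and> t \<le> e (x k)"
proof (induction n)
  case 0 show ?case by (intro exI[of _ 0]) (simp add: g_0)
next
  case (Suc n)
  then obtain k t where kt: "n = g k + t" "t \<le> e (x k)" by blast
  show ?case
  proof (cases "t = e (x k)")
    case True
    then show ?thesis using kt by (intro exI[of _ "Suc k"] exI[of _ 0]) (simp add: g_Suc)
  next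
    case False
    then show ?thesis using kt by (intro exI[of _ k] exI[of _ "Suc t"]) simp
  qed
qed

lemma markerE:
  assumes "y n = c" obtains k where "n = g k"
proof -
  obtain k t where kt: "n = g k + t" "t \<le> e (x k)" using block_decomp by blast
  show ?thesis
  proof (cases t)
    case (Suc t')
    then show ?thesis using y_inner[of t' k] kt assms h_neq by auto
  qed (use kt that in auto)
qed

lemma innerE:
  assumes "y n \<noteq> c" obtains k t where "n = Suc (g k + t)" "t < e (x k)" "y n = h (x k)"
proof -
  obtain k t where kt: "n = g k + t" "t \<le> e (x k)" using block_decomp by blast
  show ?thesis
  proof (cases t)
    case 0 then show ?thesis using kt assms by simp
  next
    case (Suc t')
    then show ?thesis using kt that[of k t'] y_inner[of t' k] by auto
  qed
qed

lemma map_y_inner: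
  assumes "t' \<le> e (x k)"
  shows "map y [Suc (g k + t)..<Suc (g k + t')] = replicate (t' - t) (h (x k))"
proof (rule nth_equalityI)
  fix m assume "m < length (map y [Suc (g k + t)..<Suc (g k + t')])"
  then have "m < t' - t" by simp
  then show "map y [Suc (g k + t)..<Suc (g k + t')] ! m = replicate (t' - t) (h (x k)) ! m"
    using y_inner[of "t + m" k] assms by (simp add: add.assoc)
qed simp

lemma map_y_blocks: "k \<le> l \<Longrightarrow> map y [g k..<Suc (g l)] = c # enc (map x [k..<l])"
proof (induction l rule: dec_induct)
  case (step l)
  have "[g k..<Suc (g (Suc l))]
      = [g k..<Suc (g l)] @ [Suc (g l + 0)..<Suc (g l + e (x l))] @ [g (Suc l)]"
  proof -
    have "g k \<le> g l" using step.hyps by simp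
    then have "g k \<le> Suc (g l)" "g k \<le> Suc (g l + e (x l))" by linarith+
    then show ?thesis
      using upt_add_eq_append[of "g k" "Suc (g l)" "e (x l)"]
        upt_Suc_append[of "g k" "Suc (g l + e (x l))"] by (simp add: g_Suc)
  qed
  then have "map y [g k..<Suc (g (Suc l))]
      = (c # enc (map x [k..<l])) @ replicate (e (x l)) (h (x l)) @ [c]"
    by (simp only: map_append step.IH map_y_inner[OF order_refl]) simp
  then show ?case using step.hyps by (simp add: upt_Suc)
qed simp

text \<open>The factor takes the last \<open>q\<close> letters of block \<open>k\<close>, all blocks
  strictly between, and the marker and first \<open>q'\<close> further letters of block
  \<open>l\<close>.\<close>

lemma map_y_span:
  assumes "k < l" "q \<le> e (x k)" "q' \<le> e (x l)"
  shows "map y [g (Suc k) - q..<Suc (g l + q')]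
    = replicate q (h (x k)) @ (c # enc (map x [Suc k..<l])) @ replicate q' (h (x l))"
proof -
  have "[g (Suc k) - q..<Suc (g l + q')]
      = [g (Suc k) - q..<g (Suc k)] @ [g (Suc k)..<Suc (g l)] @ [Suc (g l)..<Suc (g l + q')]"
  proof -
    have "g (Suc k) - q \<le> g (Suc k)" "g (Suc k) \<le> Suc (g l)" "Suc (g l) \<le> Suc (g l + q')"
      using assms(1) by (auto intro: le_SucI)
    then show ?thesis by (metis le_trans upt_append)
  qed
  moreover have "map y [g (Suc k) - q..<g (Suc k)] = replicate q (h (x k))"
    using map_y_inner[of "e (x k)" k "e (x k) - q"] assms(2) by (simp add: g_Suc Suc_diff_le)
  moreover have "map y [Suc (g l)..<Suc (g l + q')] = replicate q' (h (x l))"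
    using map_y_inner[of q' l 0] assms(3) by simp
  ultimately show ?thesis
    using map_y_blocks[of "Suc k" l] assms(1) by simp
qed

text \<open>The word begins and ends with a marker, so each of its occurrences is cut at block
  boundaries and can be decoded.\<close>

lemma occurs_enc:
  "occurs y (c # enc w) i \<longleftrightarrow> (\<exists>k. i = g k \<and> occurs x w k)"
proof
  assume "occurs y (c # enc w) i"
  then have eq: "map y [i..<Suc (i + length (enc w))] = c # enc w"
    by (simp add: occurs_def)
  have "y i = c" using eq by (simp add: upt_conv_Cons)
  then obtain k where k: "i = g k" by (rule markerE)
  have "y (i + length (enc w)) = last (map y [i..<Suc (i + length (enc w))])"
    by (simp add: last_map)
  also have "\<dots> = last (c # enc w)" unfolding eq ..
  also have "\<dots> = c" by (cases w rule: rev_cases) auto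
  finally obtain l where l: "i + length (enc w) = g l" by (rule markerE)
  have "k \<le> l" using k l by (metis g_le_iff le_add1)
  then have "enc (map x [k..<l]) = enc w" using eq map_y_blocks[of k l] k l by simp
  then have "map x [k..<l] = w" by (rule enc_inj)
  moreover from this have "length w = l - k" by auto
  ultimately show "\<exists>k. i = g k \<and> occurs x w k" using k \<open>k \<le> l\<close> by (auto simp: occurs_def)
next
  assume "\<exists>k. i = g k \<and> occurs x w k"
  then obtain k where k: "i = g k" "map x [k..<k + length w] = w" by (auto simp: occurs_def)
  have eq: "map y [g k..<Suc (g (k + length w))] = c # enc w"
    using map_y_blocks[of k "k + length w"] k by simp
  have "Suc (g (k + length w)) = g k + length (c # enc w)"
    using arg_cong[OF eq, of length] by simp
  then show "occurs y (c # enc w) i" using eq k by (simp add: occurs_def)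
qed

lemma g_add_enc:
  assumes "occurs x w k" shows "g (k + length w) = g k + length (enc w)"
proof -
  have eq: "map y [g k..<Suc (g (k + length w))] = c # enc w"
    using map_y_blocks[of k "k + length w"] assms by (simp add: occurs_def)
  show ?thesis
    using arg_cong[OF eq, of length] by simp
qed

text \<open>The increasing map \<open>g\<close> matches occurrences of \<open>w\<close> with those
  of its code, hence also consecutive ones. The complete return in \<open>y\<close> is the code of
  the one in \<open>x\<close>.\<close>

lemma pal_returns_enc:
  assumes "pal_returns x w" shows "pal_returns y (c # enc w)"
  unfolding pal_returns_def
proof (intro allI impI)
  fix i j assume c: "consecutive (occurs y (c # enc w)) i j"
  then obtain k l where kl: "i = g k" "occurs x w k" "j = g l" "occurs x w l"
    by (auto simp: consecutive_def occurs_enc)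
  have "\<not> occurs x w m" if "k < m" "m < l" for m
    using c kl that g_less_iff unfolding consecutive_def by (metis occurs_enc)
  then have "consecutive (occurs x w) k l" using c kl by (auto simp: consecutive_def)
  then have "palindrome (map x [k..<l + length w])"
    using assms by (simp add: pal_returns_def)
  then have "palindrome (map y [g k..<Suc (g (l + length w))])"
    using map_y_blocks[of k "l + length w"] c kl palindrome_enc
    by (auto simp: consecutive_def)
  then show "palindrome (map y [i..<j + length (c # enc w)])"
    using kl g_add_enc[of w l] by simp
qed

text \<open>By palindromicity of the blocks, the left and right context conditions that a window
  imposes on the enclosing blocks are the same; this is the set of letters meeting them.\<close>
definition context_set :: "'b set \<Rightarrow> 'b list \<Rightarrow> 'a set" where
  "context_set S a = {z. length a < e z \<and> h z \<in> S \<and> a = replicate (length a) (h z)}"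

text \<open>The flanks are not markers, so each lies in the power of some block; a marker between
  them forces the two blocks to be different.\<close>

lemma window_marker_decomp:
  assumes "c \<notin> S" "c \<in> set v" "window y S (Suc (length v)) v i"
  obtains k l q q' where "k < l" "q < e (x k)" "q' < e (x l)" "h (x k) \<in> S" "h (x l) \<in> S"
    "Suc i = g (Suc k) - q" "i + Suc (length v) = Suc (g l + q')"
    "v = replicate q (h (x k)) @ (c # enc (map x [Suc k..<l])) @ replicate q' (h (x l))"
proof -
  have w: "y i \<in> S" "y (i + Suc (length v)) \<in> S" "map y [Suc i..<i + Suc (length v)] = v"
    using assms(3) by (auto simp: window_def)
  have "y i \<noteq> c" using w(1) assms(1) by auto
  then obtain k t where k: "i = Suc (g k + t)" "t < e (x k)" "y i = h (x k)" by (rule innerE)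
  have "y (i + Suc (length v)) \<noteq> c" using w(2) assms(1) by auto
  then obtain l q' where l: "i + Suc (length v) = Suc (g l + q')" "q' < e (x l)"
      "y (i + Suc (length v)) = h (x l)" by (rule innerE)
  have "c \<in> y ` {Suc i..<i + Suc (length v)}"
    using assms(2) w(3) by (metis list.set_map set_upt)
  then obtain p where p: "Suc i \<le> p" "p < i + Suc (length v)" "y p = c" by auto
  obtain m where m: "p = g m" using p(3) by (rule markerE)
  have "g k < g m" using p k(1) m by linarith
  moreover have "g m < g (Suc l)" using p l m g_Suc[of l] by linarith
  ultimately have "k < l" unfolding g_less_iff by simp
  \<comment> \<open>The left flank has index \<open>t\<close>, counted from 0, in the power of block
    \<open>k\<close>; \<open>q\<close> letters of that power follow it.\<close>
  define q where "q = e (x k) - Suc t"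
  have i: "Suc i = g (Suc k) - q" using k by (simp add: q_def g_Suc)
  show ?thesis
  proof (rule that[of k l q q'])
    show "v = replicate q (h (x k)) @ (c # enc (map x [Suc k..<l])) @ replicate q' (h (x l))"
      using map_y_span[OF \<open>k < l\<close>, of q q'] w(3) l(1,2) k(2) i by (simp add: q_def)
  qed (use \<open>k < l\<close> k l w i in \<open>auto simp: q_def\<close>)
qed

text \<open>Unique decoding identifies the borders of \<open>v\<close> with pieces of the two
  enclosing blocks. Each of these blocks must have one more letter beyond its piece, the flank, and
  it must lie in \<open>S\<close>.\<close>

lemma window_enc:
  assumes "c \<notin> S" "c \<notin> set a" and v: "v = a @ (c # enc w) @ rev a"
  shows "window y S (Suc (length v)) v i \<longleftrightarrow>
    (\<exists>k. Suc i = g (Suc k) - length a \<and> window x (context_set S a) (Suc (length w)) w k)"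
proof
  assume win: "window y S (Suc (length v)) v i"
  obtain k l q q' where kl: "k < l" "q < e (x k)" "q' < e (x l)" "h (x k) \<in> S" "h (x l) \<in> S"
    "Suc i = g (Suc k) - q"
    "v = replicate q (h (x k)) @ (c # enc (map x [Suc k..<l])) @ replicate q' (h (x l))"
    using window_marker_decomp[OF assms(1) _ win] v by (metis Un_iff list.set_intros(1) set_append)
  have "replicate q (h (x k)) = a \<and> map x [Suc k..<l] = w \<and> replicate q' (h (x l)) = rev a"
    by (rule enc_decomp_unique) (use kl(7) v assms(2) h_neq in auto)
  then have *: "a = replicate q (h (x k))" "map x [Suc k..<l] = w" "rev a = replicate q' (h (x l))"
    by auto
  have q: "q = length a" using *(1) by simp
  have q': "q' = length a" using arg_cong[OF *(3), of length] by simp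
  have a': "a = replicate q' (h (x l))" using arg_cong[OF *(3), of rev] by simp
  have l: "l = k + Suc (length w)" using *(2) kl(1) by auto
  have "x k \<in> context_set S a" "x l \<in> context_set S a"
    unfolding context_set_def mem_Collect_eq using kl *(1) a' q q' by metis+
  then have "window x (context_set S a) (Suc (length w)) w k"
    using *(2) unfolding window_def l by blast
  then show "\<exists>k. Suc i = g (Suc k) - length a
      \<and> window x (context_set S a) (Suc (length w)) w k"
    using kl(6) q by blast
next
  assume "\<exists>k. Suc i = g (Suc k) - length a \<and> window x (context_set S a) (Suc (length w)) w k"
  then obtain k where k: "Suc i = g (Suc k) - length a"
    and win: "window x (context_set S a) (Suc (length w)) w k" by blast
  define l where "l = k + Suc (length w)"
  define q where "q = length a"
  have w: "map x [Suc k..<l] = w" "q < e (x k)" "q < e (x l)" "h (x k) \<in> S" "h (x l) \<in> S"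
    "a = replicate q (h (x k))" "a = replicate q (h (x l))"
    using win by (auto simp: window_def context_set_def l_def q_def)
  have "occurs x w (Suc k)" using w(1) by (simp add: occurs_def l_def)
  from g_add_enc[OF this] have gl: "g l = g (Suc k) + length (enc w)" by (simp add: l_def)
  have i: "i = Suc (g k + (e (x k) - Suc q))" using k w(2) g_Suc[of k] q_def by linarith
  have iv: "i + Suc (length v) = Suc (g l + q)"
  proof -
    have "length v = Suc (length (enc w) + 2 * q)" by (simp add: v q_def)
    then show ?thesis using i gl w(2) g_Suc[of k] by linarith
  qed
  have "y i \<in> S" unfolding i using y_inner[of "e (x k) - Suc q" k] w(2,4) by simp
  moreover have "y (i + Suc (length v)) \<in> S" unfolding iv using y_inner[of q l] w(3,5) by simp
  moreover have "map y [Suc i..<Suc (g l + q)] = v"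
  proof -
    have "rev a = replicate q (h (x l))" using w(7) by (metis rev_replicate)
    moreover have "map y [g (Suc k) - q..<Suc (g l + q)]
        = replicate q (h (x k)) @ (c # enc (map x [Suc k..<l])) @ replicate q (h (x l))"
      by (rule map_y_span) (use w(2,3) in \<open>auto simp: l_def\<close>)
    moreover have "Suc i = g (Suc k) - q" using k by (simp only: q_def)
    ultimately show ?thesis using w(1,6) unfolding v by metis
  qed
  ultimately show "window y S (Suc (length v)) v i" unfolding window_def iv by blast
qed

text \<open>Windows of \<open>v\<close> in \<open>y\<close> correspond, in the same order, to
  windows of \<open>w\<close> in \<open>x\<close>. The return in \<open>y\<close> is the code of the
  return in \<open>x\<close> between the borders \<open>a\<close> and \<open>rev a\<close>.\<close>

lemma window_returns_enc:
  assumes S: "c \<notin> S" "c \<notin> set a" and v: "v = a @ (c # enc w) @ rev a"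
    and ret: "window_returns x (context_set S a) (Suc (length w)) w"
  shows "window_returns y S (Suc (length v)) v"
  unfolding window_returns_def
proof (intro allI impI)
  let ?W = "window x (context_set S a) (Suc (length w)) w"
  note we = window_enc[OF S v]
  fix i j assume con: "consecutive (window y S (Suc (length v)) v) i j"
  then obtain k k' where k: "Suc i = g (Suc k) - length a" "?W k"
    and k': "Suc j = g (Suc k') - length a" "?W k'"
    unfolding consecutive_def we by blast
  have "length a < e (x m)" if "?W m" for m using that by (auto simp: window_def context_set_def)
  \<comment> \<open>This keeps \<open>g (Suc m) - length a\<close> from being truncated, so that
    window positions are ordered like the block indices.\<close>
  then have pos: "length a < g (Suc m)" if "?W m" for m using that by (fastforce simp: g_Suc)
  have mono: "m < m' \<longleftrightarrow> g (Suc m) - length a < g (Suc m') - length a" if "?W m" "?W m'" for m m'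
    using pos[OF that(1)] pos[OF that(2)] g_less_iff[of "Suc m" "Suc m'"] by linarith
  have "\<not> ?W m" if "k < m" "m < k'" for m
  proof
    assume m: "?W m"
    define p where "p = g (Suc m) - length a - 1"
    have p: "Suc p = g (Suc m) - length a" using pos[OF m] by (simp add: p_def)
    then have "window y S (Suc (length v)) v p" using m we by blast
    moreover have "i < p" "p < j"
      using mono[OF k(2) m] mono[OF m k'(2)] that p k k' by auto
    ultimately show False using con by (auto simp: consecutive_def)
  qed
  moreover have "k < k'" using mono[OF k(2) k'(2)] con k k' by (auto simp: consecutive_def)
  ultimately have "consecutive ?W k k'" using k k' by (simp add: consecutive_def)
  define l where "l = k' + Suc (length w)"
  with \<open>consecutive ?W k k'\<close> have pal: "palindrome (map x [Suc k..<l])"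
    using ret by (simp add: window_returns_def)
  define q where "q = length a"
  have ql: "q < e (x k)" "q < e (x l)" "q < e (x k')" "a = replicate q (h (x k))"
    "a = replicate q (h (x l))"
    using k(2) k'(2) by (auto simp: window_def context_set_def l_def q_def)
  have ra: "rev a = replicate q (h (x l))" using ql(5) by (metis rev_replicate)
  have "occurs x w (Suc k')" using k'(2) by (auto simp: occurs_def window_def)
  from g_add_enc[OF this] have gl: "g l = g (Suc k') + length (enc w)" by (simp add: l_def)
  have jv: "j + Suc (length v) = Suc (g l + q)"
    using k'(1) pos[OF k'(2)] gl by (simp add: v q_def)
  have k1: "Suc i = g (Suc k) - q" using k(1) by (simp only: q_def)
  have span: "map y [g (Suc k) - q..<Suc (g l + q)]
      = replicate q (h (x k)) @ (c # enc (map x [Suc k..<l])) @ replicate q (h (x l))"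
    by (rule map_y_span) (use ql(1,2) \<open>k < k'\<close> in \<open>auto simp: l_def\<close>)
  have "map y [Suc i..<j + Suc (length v)] = a @ (c # enc (map x [Suc k..<l])) @ rev a"
    unfolding jv k1 span using ql(4) ra by metis
  then show "palindrome (map y [Suc i..<j + Suc (length v)])"
    using palindrome_enc_enclose[OF pal] by simp
qed

text \<open>Both \<open>v\<close> and its reverse decompose into border, code and border; uniqueness
  makes the borders mirror images and \<open>w\<close> a palindrome.\<close>

lemma window_marker_palindrome:
  assumes "c \<notin> S" "c \<in> set v" "palindrome v" "window y S (Suc (length v)) v i"
  obtains a w where "c \<notin> set a" "palindrome w" "v = a @ (c # enc w) @ rev a"
proof -
  obtain a w b where v: "v = a @ (c # enc w) @ b" and ab: "c \<notin> set a" "c \<notin> set b"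
    using window_marker_decomp[OF assms(1,2,4)] marker_notin by metis
  have "rev v = rev b @ (c # enc (rev w)) @ rev a"
    using v rev_enc[of w] by simp
  then have "a @ c # enc w @ b = rev b @ c # enc (rev w) @ rev a"
    using assms(3) v by (simp add: palindrome_def)
  then have "a = rev b \<and> w = rev w \<and> b = rev a"
    by (rule enc_decomp_unique) (use ab in auto)
  then have "b = rev a" "palindrome w" unfolding palindrome_def by metis+
  with v ab that show ?thesis by blast
qed

text \<open>If \<open>v\<close> has no window, nothing is claimed; otherwise it decodes to a
  palindrome \<open>w\<close>, which is shorter because each letter of \<open>w\<close> contributes
  a marker and one more marker is in front.\<close>

lemma window_returns_marker:
  assumes "c \<notin> S" "c \<in> set v" "palindrome v"
    and "\<And>a w. palindrome w \<Longrightarrow> length w < length v \<Longrightarrow>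
      window_returns x (context_set S a) (Suc (length w)) w"
  shows "window_returns y S (Suc (length v)) v"
proof (cases "\<exists>i. window y S (Suc (length v)) v i")
  case True
  then obtain a w where aw: "c \<notin> set a" "palindrome w" "v = a @ (c # enc w) @ rev a"
    using window_marker_palindrome[OF assms(1-3)] by metis
  have "length w \<le> length (enc w)" by (induction w) auto
  then have "length w < length v" using aw(3) by simp
  then show ?thesis using window_returns_enc[OF assms(1) aw(1,3)] assms(4) aw(2) by blast
next
  case False
  then show ?thesis unfolding window_returns_def consecutive_def by blast
qed

text \<open>The outer markers make the word a code \<open>c # enc w\<close>, and injectivity makes
  \<open>w\<close> a palindrome. The bound on the length of \<open>w\<close> is the length of
  \<open>enc w\<close>.\<close>

lemma pal_returns_marker:
  assumes "palindrome (c # v @ [c])"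
    and "\<And>w. palindrome w \<Longrightarrow> length w \<le> Suc (length v) \<Longrightarrow> pal_returns x w"
  shows "pal_returns y (c # v @ [c])"
proof (cases "\<exists>i. occurs y (c # v @ [c]) i")
  case True
  then obtain i where i: "occurs y (c # v @ [c]) i" by blast
  then have eq: "map y [i..<Suc (i + Suc (length v))] = c # v @ [c]"
    by (simp add: occurs_def)
  have "y i = c" using eq by (simp add: upt_conv_Cons)
  then obtain k where k: "i = g k" by (rule markerE)
  have "y (i + Suc (length v)) = last (map y [i..<Suc (i + Suc (length v))])"
    by (simp add: last_map)
  also have "\<dots> = c" unfolding eq by simp
  finally have "y (i + Suc (length v)) = c" .
  then obtain l where l: "i + Suc (length v) = g l" by (rule markerE)
  define w where "w = map x [k..<l]"
  have "g k < g l" using k l by linarith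
  then have "k < l" by simp
  then have w: "c # v @ [c] = c # enc w"
    using eq[unfolded l] map_y_blocks[of k l] by (simp only: k w_def less_imp_le)
  have "c # enc w = c # enc (rev w)"
    using assms(1) rev_enc[of w] unfolding w palindrome_def by simp
  then have "palindrome w" using enc_inj by (simp add: palindrome_def)
  moreover have "length w \<le> length (enc w)" by (induction w) auto
  moreover have "length (enc w) = Suc (length v)"
    using arg_cong[OF w, of length] by simp
  ultimately show ?thesis unfolding w by (intro pal_returns_enc assms(2)) auto
next
  case False
  then show ?thesis unfolding pal_returns_def consecutive_def by blast
qed

text \<open>Windows inside one block: the last one in its block and the first one in a later block
  are at distance zero from the block ends.\<close>
lemma window_returns_no_marker:
  assumes S: "c \<notin> S" and v: "c \<notin> set v"
    and ret: "window_returns x {z. n < e z \<and> h z \<in> S} 0 []"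
  shows "window_returns y S n v"
  unfolding window_returns_def
proof (intro allI impI)
  let ?S = "{z. n < e z \<and> h z \<in> S}"
  fix i j assume con: "consecutive (window y S n v) i j"
  \<comment> \<open>A block boundary between the flanks would put a marker into \<open>v\<close>, so
    a window stays inside one power. For \<open>n = 0\<close> the exponent \<open>n - 1\<close> is 0
    and \<open>v\<close> is empty.\<close>
  have dec: "\<exists>k t. p = Suc (g k + t) \<and> t + n < e (x k) \<and> h (x k) \<in> S
      \<and> v = replicate (n - 1) (h (x k))"
    if win: "window y S n v p" for p
  proof -
    have w: "y p \<in> S" "y (p + n) \<in> S" "map y [Suc p..<p + n] = v"
      using win by (auto simp: window_def)
    have "y p \<noteq> c" using w(1) S by auto
    then obtain k t where k: "p = Suc (g k + t)" "t < e (x k)" "y p = h (x k)" by (rule innerE)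
    have "y (p + n) \<noteq> c" using w(2) S by auto
    then obtain l t' where l: "p + n = Suc (g l + t')" "t' < e (x l)" by (rule innerE)
    have "\<not> k < l"
    proof
      assume "k < l"
      then have "g (Suc k) \<le> g l" unfolding g_le_iff by simp
      then have "g l \<in> {Suc p..<p + n}" using k l by (simp add: g_Suc)
      then have "y (g l) \<in> set v" unfolding w(3)[symmetric] by (metis imageI list.set_map set_upt)
      then show False using v by simp
    qed
    moreover have "\<not> l < k"
    proof
      assume "l < k"
      then have "g (Suc l) \<le> g k" unfolding g_le_iff by simp
      then show False using k l by (simp add: g_Suc)
    qed
    ultimately have "l = k" by simp
    then have tn: "t' = t + n" using k l by simp
    then have "map y [Suc (g k + Suc t)..<Suc (g k + t')] = replicate (t' - Suc t) (h (x k))"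
      using l \<open>l = k\<close> by (intro map_y_inner) simp
    then have "v = replicate (n - 1) (h (x k))"
      using w(3) k(1) tn by (simp add: add_ac)
    with k l \<open>l = k\<close> tn w show ?thesis by (metis)
  qed
  have winI: "window y S n v (Suc (g k + t))"
    if "t + n < e (x k)" "h (x k) \<in> S" "v = replicate (n - 1) (h (x k))" for k t
    using that y_inner[of t k] y_inner[of "t + n" k] map_y_inner[of "t + n" k "Suc t"]
    by (simp add: window_def add_ac)
  obtain k t where k: "i = Suc (g k + t)" "t + n < e (x k)" "h (x k) \<in> S"
      "v = replicate (n - 1) (h (x k))"
    using dec con by (metis consecutive_def)
  obtain k' t' where k': "j = Suc (g k' + t')" "t' + n < e (x k')" "h (x k') \<in> S"
      "v = replicate (n - 1) (h (x k'))"
    using dec con by (metis consecutive_def)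
  have ij: "i < j" using con by (simp add: consecutive_def)
  have "k \<le> k'"
  proof (rule ccontr)
    assume "\<not> k \<le> k'"
    then have "g (Suc k') \<le> g k" unfolding g_le_iff by simp
    then show False using ij k k' by (simp add: g_Suc)
  qed
  show "palindrome (map y [Suc i..<j + n])"
  proof (cases "k = k'")
    case True
    \<comment> \<open>A later window in the same block leaves room for one shifted by a single
      position. So \<open>j = Suc i\<close>, and the return is a power of one letter.\<close>
    have "window y S n v (Suc (g k + Suc t))"
      by (rule winI) (use k k' True ij in auto)
    then have "Suc i = j" using k ij by (intro consecutiveI_unique[OF con]) auto
    then have "map y [Suc i..<j + n] = map y [Suc (g k + Suc t)..<Suc (g k + (Suc t + n))]"
      using k(1) by (simp add: add_ac flip: \<open>Suc i = j\<close>)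
    also have "\<dots> = replicate (Suc t + n - Suc t) (h (x k))"
      by (rule map_y_inner) (use k' True k \<open>Suc i = j\<close> in auto)
    finally show ?thesis by simp
  next
    case False
    with \<open>k \<le> k'\<close> have "k < k'" by simp
    then have gk: "g (Suc k) \<le> g k'" unfolding g_le_iff by simp
    have t: "t + Suc n = e (x k)"
    proof (rule ccontr)
      assume "t + Suc n \<noteq> e (x k)"
      then have "window y S n v (Suc (g k + Suc t))" using k by (intro winI) auto
      moreover have "Suc i < j" using gk k k' by (simp add: g_Suc)
      ultimately show False using k con by (auto simp: consecutive_def)
    qed
    have t': "t' = 0"
    proof (rule ccontr)
      assume "t' \<noteq> 0"
      then have "window y S n v (Suc (g k' + (t' - 1)))" using k' by (intro winI) auto
      moreover have "i < j - 1" using gk k k' \<open>t' \<noteq> 0\<close> by (simp add: g_Suc)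
      ultimately show False using k' con \<open>t' \<noteq> 0\<close> by (auto simp: consecutive_def)
    qed
    \<comment> \<open>For \<open>0 < n\<close> both exponents are at least 2, so
      \<open>long_blocks\<close> applies; for \<open>n = 0\<close> the powers of length
      \<open>n\<close> are empty and the letter does not matter.\<close>
    have heq: "n = 0 \<or> h (x m) = h (x k)" if "n < e (x m)" for m
      using long_blocks[of "x m" "x k"] that k(2) by linarith
    have "x m \<notin> ?S" if m: "k < m" "m < k'" for m
    proof
      assume xm: "x m \<in> ?S"
      have "v = replicate (n - 1) (h (x m))" using k(4) heq[of m] xm by auto
      then have "window y S n v (Suc (g m + 0))" using xm by (intro winI) auto
      moreover have "i < Suc (g m)" "Suc (g m) < j"
      proof -
        have "g (Suc k) \<le> g m" "g m < g k'" using m unfolding g_le_iff g_less_iff by auto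
        then show "i < Suc (g m)" "Suc (g m) < j"
          using k(1,2) k'(1) t' xm g_Suc[of m] g_Suc[of k] by linarith+
      qed
      ultimately show False using con by (simp add: consecutive_def)
    qed
    then have "consecutive (window x ?S 0 []) k k'"
      using \<open>k < k'\<close> k k' by (auto simp: consecutive_def window_def)
    then have pal: "palindrome (map x [Suc k..<k'])"
      using ret by (auto simp: window_returns_def)
    have "replicate n (h (x k')) = rev (replicate n (h (x k)))"
      using heq[of k'] k' t' by auto
    moreover have "Suc i = g (Suc k) - n" using k(1) t by (simp add: g_Suc)
    moreover have "j + n = Suc (g k' + n)" using k' t' by simp
    ultimately have "map y [Suc i..<j + n]
        = replicate n (h (x k)) @ (c # enc (map x [Suc k..<k'])) @ rev (replicate n (h (x k)))"
      using map_y_span[OF \<open>k < k'\<close>, of n n] k k' t' by simp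
    then show ?thesis using palindrome_enc_enclose[OF pal] by (simp only:)
  qed
qed

end

lemma power_blocks_stream:
  fixes s :: "'a stream"
  assumes "\<And>z. h z \<noteq> c"
    and "\<And>z z'. replicate (e z) (h z) = replicate (e z') (h z') \<Longrightarrow> z = z'"
    and "\<And>z z'. 2 \<le> e z \<Longrightarrow> 2 \<le> e z' \<Longrightarrow> h z = h z'"
    and f: "\<And>z. f z = c # replicate (e z) (h z)"
  shows "power_blocks c h e (snth s) (snth (morphism_stream f s))
    (\<lambda>k. length (concat (map f (stake k s))))"
proof
  fix k
  show "length (concat (map f (stake (Suc k) s)))
      = Suc (length (concat (map f (stake k s))) + e (s !! k))"
    by (simp add: stake_Suc f del: stake.simps)
  fix t assume t: "t \<le> e (s !! k)"
  let ?p = "concat (map f (stake k s))" and ?r = "morphism_stream f (sdrop (Suc k) s)"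
  have ne: "f z \<noteq> []" for z by (simp add: f)
  have s: "s = stake k s @- [s !! k] @- sdrop (Suc k) s"
    by (metis id_stake_snth_sdrop shift.simps)
  have "morphism_stream f (stake k s @- [s !! k] @- sdrop (Suc k) s) = ?p @- f (s !! k) @- ?r"
    by (simp only: morphism_stream_shift[OF ne]) simp
  then have "morphism_stream f s !! (length ?p + t) = (?p @- f (s !! k) @- ?r) !! (length ?p + t)"
    using s by argo
  also have "\<dots> = (f (s !! k) @- ?r) !! t"
    by (subst shift_snth_ge) (simp_all only: le_add1 add_diff_cancel_left')
  also have "\<dots> = f (s !! k) ! t"
    by (rule shift_snth_less) (use t in \<open>simp add: f\<close>)
  finally show "morphism_stream f s !! (length ?p + t)
      = (c # replicate (e (s !! k)) (h (s !! k))) ! t" by (simp only: f)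
next
  show "length (concat (map f (stake 0 s))) = 0" by simp
qed (fact assms)+

subsection \<open>The fixed point and its binary image\<close>

text \<open>Two shapes are used because \<open>h\<close> sends both \<open>d - 2\<close> and
  \<open>d - 1\<close> to \<open>d - 1\<close>: among the letters of \<open>u\<close>, the preimage
  of the singleton of \<open>d - 1\<close> is \<open>{d - 2..}\<close>.\<close>

definition threshold_set :: "nat set \<Rightarrow> bool" where
  "threshold_set S \<longleftrightarrow> (\<exists>m. S = {m} \<or> S = {m..})"

lemma threshold_setI [simp]: "threshold_set {m}" "threshold_set {m..}"
  by (auto simp: threshold_set_def)

context
  fixes d :: nat and u :: "nat \<Rightarrow> nat" and g :: "nat \<Rightarrow> nat"
    and h e :: "nat \<Rightarrow> nat"
  defines "h \<equiv> \<lambda>i. if i = d - 1 then d - 1 else i + 1"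
    and "e \<equiv> \<lambda>i. if i = d - 1 then 2 else 1"
  assumes d: "2 \<le> d" and u_less: "\<And>n. u n < d"
    and blocks: "power_blocks 0 h e u u g"
begin

interpretation power_blocks 0 h e u u g by (rule blocks)

lemma h_preimage:
  "0 < m \<Longrightarrow> m < d - 1 \<Longrightarrow> {z. h z = m} \<inter> range u = {m - 1} \<inter> range u"
  "{z. h z = d - 1} \<inter> range u = {d - 2..} \<inter> range u"
  "0 < m \<Longrightarrow> m < d \<Longrightarrow> {z. m \<le> h z} \<inter> range u = {m - 1..} \<inter> range u"
  "d \<le> m \<Longrightarrow> {z. h z = m} \<inter> range u = {}"
  "d \<le> m \<Longrightarrow> {z. m \<le> h z} \<inter> range u = {}"
proof -
  have eq: "A \<inter> range u = B \<inter> range u" if "\<And>z. z < d \<Longrightarrow> z \<in> A \<longleftrightarrow> z \<in> B" for A B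
    using that u_less by auto
  show "{z. h z = m} \<inter> range u = {m - 1} \<inter> range u" if "0 < m" "m < d - 1"
    by (rule eq) (use that in \<open>auto simp: h_def\<close>)
  show "{z. h z = d - 1} \<inter> range u = {d - 2..} \<inter> range u"
    by (rule eq) (use d in \<open>auto simp: h_def\<close>)
  show "{z. m \<le> h z} \<inter> range u = {m - 1..} \<inter> range u" if "0 < m" "m < d"
    by (rule eq) (use that in \<open>auto simp: h_def\<close>)
  have "{z. h z = m} \<inter> range u = {} \<inter> range u" if "d \<le> m"
    by (rule eq) (use that d in \<open>auto simp: h_def\<close>)
  then show "{z. h z = m} \<inter> range u = {}" if "d \<le> m" using that by simp
  have "{z. m \<le> h z} \<inter> range u = {} \<inter> range u" if "d \<le> m"
    by (rule eq) (use that d in \<open>auto simp: h_def\<close>)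
  then show "{z. m \<le> h z} \<inter> range u = {}" if "d \<le> m" using that by simp
qed

text \<open>Within the range of \<open>u\<close>, the preimage of \<open>S\<close> is empty or again
  of one of the two shapes, with a smaller bound \<open>k\<close>.\<close>

lemma h_preimage_window_returns:
  assumes "0 \<notin> S"
    and "S = {m} \<or> S = {m..}"
    and "\<And>T k. k < m \<Longrightarrow> T = {k} \<or> T = {k..} \<Longrightarrow> window_returns u T n v"
  shows "window_returns u {z. h z \<in> S} n v"
proof -
  have m: "0 < m" using assms(1,2) by (cases m) auto
  show ?thesis
  proof (cases "m < d")
    case False
    then have "{z. h z \<in> S} \<inter> range u = {}" using h_preimage(4,5)[of m] assms(2) by auto
    then show ?thesis by (rule window_returns_empty)
  next
    case True
    obtain k T where "k < m" "T = {k} \<or> T = {k..}" and eq: "{z. h z \<in> S} \<inter> range u = T \<inter> range u"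
    proof (cases "S = {m} \<and> m < d - 1")
      case True
      then show ?thesis using that[of "m - 1" "{m - 1}"] h_preimage(1)[of m] m by simp
    next
      case False
      show ?thesis
      proof (cases "S = {m}")
        case True
        with False \<open>m < d\<close> have "m = d - 1" by simp
        then show ?thesis using that[of "d - 2" "{d - 2..}"] h_preimage(2) True m by simp
      next
        case False
        then show ?thesis
          using that[of "m - 1" "{m - 1..}"] h_preimage(3)[of m] m \<open>m < d\<close> assms(2) by simp
      qed
    qed
    then show ?thesis using assms(3) window_returns_cong[OF eq] by blast
  qed
qed

text \<open>Since \<open>u\<close> is its own image, desubstitution lowers the bound
  \<open>m\<close> until \<open>S\<close> contains 0. Then \<open>S\<close> is everything, or it is
  \<open>{0}\<close> and the returns are codes of single letters between markers.\<close>

lemma letter_returns: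
  assumes "threshold_set S"
  shows "window_returns u S 0 []"
proof -
  obtain m where "S = {m} \<or> S = {m..}" using assms by (auto simp: threshold_set_def)
  then show ?thesis
  proof (induction m arbitrary: S rule: less_induct)
    case (less m)
    show ?case
    proof (cases "0 \<in> S")
      case False
      have "window_returns u {z. h z \<in> S} 0 []"
        using h_preimage_window_returns[OF False less.prems] less.IH by blast
      moreover have "{z. 0 < e z \<and> h z \<in> S} = {z. h z \<in> S}" by (auto simp: e_def)
      ultimately show ?thesis using window_returns_no_marker[OF False, of "[]" 0] by simp
    next
      case True
      then have "m = 0" using less.prems by auto
      then consider "S = {0}" | "S = UNIV" using less.prems by auto
      then show ?thesis
      proof cases
        case 1
        have "pal_returns u [0]" using pal_returns_enc[OF pal_returns_Nil] by simp
        then show ?thesis using 1 by (simp add: pal_returns_single)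
      next
        case 2
        then show ?thesis by (simp add: window_returns_UNIV_0)
      qed
    qed
  qed
qed

lemma e_pos: "0 < e z" and e_gt_1: "Suc n < e z \<Longrightarrow> z = d - 1"
  by (auto simp: e_def split: if_splits)

text \<open>If 0 is in \<open>S\<close>, the claim concerns complete returns of
  \<open>0 # v @ [0]\<close> or of \<open>v\<close>. Otherwise a \<open>v\<close> containing 0
  decodes to a shorter palindrome, and a \<open>v\<close> without 0 lies inside one block.\<close>

lemma inner_window_returns:
  assumes "palindrome v" "threshold_set S"
  shows "window_returns u S (Suc (length v)) v"
  using assms
proof (induction "length v" arbitrary: v S rule: less_induct)
  case less
  \<comment> \<open>The interior of a palindrome of length at most \<open>Suc (length v)\<close> is
    shorter than \<open>v\<close>, so the induction hypothesis for singletons covers it.\<close>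
  have pal: "pal_returns u w" if w: "palindrome w" "length w \<le> Suc (length v)" for w
  proof (rule pal_returnsI[OF w(1)])
    show "window_returns u {a} 0 []" for a by (rule letter_returns) simp
    show "window_returns u {a} (Suc (length w')) w'"
      if "palindrome w'" "length w = Suc (Suc (length w'))" for a w'
      using less.hyps[OF _ that(1)] that(2) w(2) by simp
  qed
  obtain m where m: "S = {m} \<or> S = {m..}" using less.prems(2) by (auto simp: threshold_set_def)
  show ?case
  proof (cases "0 \<in> S")
    case True
    then have "m = 0" using m by auto
    then consider "S = {0}" | "S = UNIV" using m by auto
    then show ?thesis
    proof cases
      case 1
      have "pal_returns u (0 # v @ [0])"
        by (rule pal_returns_marker) (use less.prems pal in auto)
      then show ?thesis using 1 by (simp add: pal_returns_enclose)
    next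
      case 2
      then show ?thesis using pal[of v] less.prems window_returns_UNIV by auto
    qed
  next
    case no0: False
    show ?thesis
    proof (cases "0 \<in> set v")
      case False
      have "{z. Suc (length v) < e z \<and> h z \<in> S} \<subseteq> {d - 1}" using e_gt_1 by auto
      then have "window_returns u {z. Suc (length v) < e z \<and> h z \<in> S} 0 []"
        by (rule window_returns_subset_single) (simp add: letter_returns)
      then show ?thesis by (rule window_returns_no_marker[OF no0 False])
    next
      case True
      show ?thesis
      proof (rule window_returns_marker[OF no0 True less.prems(1)])
        fix a w :: "nat list"
        assume w: "palindrome w" "length w < length v"
        have IH: "window_returns u T (Suc (length w)) w" if "threshold_set T" for T
          using less.hyps[OF w(2,1) that] .
        show "window_returns u (context_set S a) (Suc (length w)) w"
        proof (cases a)
          case Nil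
          then have "context_set S a = {z. h z \<in> S}" by (auto simp: context_set_def e_pos)
          then show ?thesis using h_preimage_window_returns[OF no0 m] IH threshold_setI by metis
        next
          case (Cons b a')
          \<comment> \<open>A nonempty border and a flank in the same power require exponent at
            least 2, which only the letter \<open>d - 1\<close> has.\<close>
          then have "context_set S a \<subseteq> {d - 1}"
            using e_gt_1 by (auto simp: context_set_def)
          then show ?thesis by (rule window_returns_subset_single) (simp add: IH)
        qed
      qed
    qed
  qed
qed

end

section \<open>The binary image\<close>

text \<open>Here the exponent of a letter is the letter itself, so a context condition is a lower
  bound on it, which is a threshold set, or is unsatisfiable. One desubstitution reduces everything
  to \<open>u\<close>.\<close>

lemma binary_image_pal_returns:
  assumes blocks: "power_blocks La (\<lambda>_. Lb) id u y g"
    and letters: "\<And>S. threshold_set S \<Longrightarrow> window_returns u S 0 []"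
    and words: "\<And>v S. palindrome v \<Longrightarrow> threshold_set S \<Longrightarrow> window_returns u S (Suc (length v)) v"
    and "palindrome w"
  shows "pal_returns y w"
proof -
  interpret power_blocks La "\<lambda>_. Lb" id u y g by (rule blocks)
  have no_marker: "window_returns y {Lb} n v" if "La \<notin> set v" for n v
  proof (rule window_returns_no_marker[OF _ that])
    have "{z::nat. n < id z \<and> Lb \<in> {Lb}} = {Suc n..}" by auto
    then show "window_returns u {z. n < id z \<and> Lb \<in> {Lb}} 0 []" using letters by simp
  qed simp
  show ?thesis
  proof (rule pal_returnsI[OF \<open>palindrome w\<close>])
    show "window_returns y {a} 0 []" for a
      by (cases a)
         (use no_marker pal_returns_enc[OF pal_returns_Nil] in \<open>simp_all add: pal_returns_single\<close>)
    show "window_returns y {a} (Suc (length v)) v" if v: "palindrome v" for a v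
    proof (cases a)
      case La
      have "pal_returns y (La # v @ [La])"
      proof (rule pal_returns_marker)
        show "pal_returns u w'" if "palindrome w'" for w'
          by (rule pal_returnsI[OF that]) (use letters words in simp_all)
      qed (use v in simp)
      then show ?thesis using La by (simp add: pal_returns_enclose)
    next
      case Lb
      show ?thesis
      proof (cases "La \<in> set v")
        case True
        show ?thesis
          unfolding Lb
        proof (rule window_returns_marker[OF _ True v])
          fix a and w :: "nat list" assume w: "palindrome w"
          have "context_set {Lb} a = {Suc (length a)..} \<or> context_set {Lb} a = {}"
            by (cases "a = replicate (length a) Lb") (auto simp: context_set_def)
          then show "window_returns u (context_set {Lb} a) (Suc (length w)) w"
            using words[OF w] window_returns_empty[of "{}"] by auto
        qed simp
      qed (use no_marker Lb in simp)
    qed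
  qed
qed

theorem theorem24:
  fixes d :: nat
  assumes "d \<ge> 3"
  shows "rich_stream (morphism_stream pi_map (u_word d))"
proof (rule rich_streamI)
  fix w :: "binary_letter list" assume w: "palindrome w"
  let ?u = "u_word d" and ?h = "\<lambda>i. if i = d - 1 then d - 1 else i + 1"
    and ?e = "\<lambda>i. if i = d - 1 then 2 else 1 :: nat"
  have d: "2 \<le> d" using assms by simp
  have "?u \<in> streams {..<d} \<and> shd ?u = 0 \<and> morphism_stream (phi d) ?u = ?u"
    unfolding u_word_def by (rule theI'[OF ex1_u_word[OF d]])
  then have u: "?u \<in> streams {..<d}" "morphism_stream (phi d) ?u = ?u"
    by blast+
  have "power_blocks 0 ?h ?e (snth ?u) (snth (morphism_stream (phi d) ?u))
      (\<lambda>k. length (concat (map (phi d) (stake k ?u))))"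
  proof (rule power_blocks_stream)
    show "z = z'" if "replicate (?e z) (?h z) = replicate (?e z') (?h z')" for z z'
      using that by (cases "z = d - 1"; cases "z' = d - 1") (simp_all del: One_nat_def)
    show "?h z \<noteq> 0" for z using d by simp
    show "?h z = ?h z'" if "2 \<le> ?e z" "2 \<le> ?e z'" for z z'
      using that by (simp split: if_splits)
    show "phi d z = 0 # replicate (?e z) (?h z)" for z
      by (simp add: phi_def numeral_2_eq_2)
  qed
  \<comment> \<open>The fixed point equation lets \<open>u\<close> serve as both the word and its
    image.\<close>
  then have blocks: "power_blocks 0 ?h ?e (snth ?u) (snth ?u)
      (\<lambda>k. length (concat (map (phi d) (stake k ?u))))"
    unfolding u(2) .
  have less: "?u !! n < d" for n using u(1) by (auto simp: streams_iff_snth)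
  \<comment> \<open>The block of the letter 0 is the marker alone, with exponent 0.\<close>
  have "power_blocks La (\<lambda>_. Lb) id (snth ?u) (snth (morphism_stream pi_map ?u))
      (\<lambda>k. length (concat (map pi_map (stake k ?u))))"
    by (rule power_blocks_stream) (auto simp: pi_map_def)
  then show "pal_returns (snth (morphism_stream pi_map ?u)) w"
    using letter_returns[OF d less blocks] inner_window_returns[OF d less blocks] w
    by (rule binary_image_pal_returns)
qed

end
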